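(* Let $h,k$ be coprime positive integers and let $\Delta\subset\mathbb{R}^2$ be the closed triangle with vertices $(0,0)$, $(h,0)$ and $(0,k)$. Then for every nonzero real number $t$, \begin{align*} A_{\Delta}(t) &= \frac{hk}{2}t^2-\bar{B}_1(hkt)\,t + \frac{1}{2hk}\left(\bar{B}_2(hkt)+\frac{h^2+k^2}{6}\right) \\ &\quad -s(h,k;ht,0)-s(k,h;kt,0) - \frac{\arctan(h/k)}{2\pi}\mathbf{1}_{\mathbb{Z}}(ht) - \frac{\arctan(k/h)}{2\pi}\mathbf{1}_{\mathbb{Z}}(kt). \end{align*}
   Context: For a closed polygon $\mathcal{P}\subset\mathbb{R}^2$ and $x\in\mathbb{R}^2$, the solid angle $\omega_{\mathcal{P}}(x)$ is $1$ if $x$ is in the interior of $\mathcal{P}$, $0$ if $x\notin\mathcal{P}$, $1/2$ if $x$ lies in the relative interior of an edge of $\mathcal{P}$, and $\theta_x/(2\pi)$ if $x$ is a vertex of $\mathcal{P}$ with interior angle $\theta_x$ (in radians). For real $t$, $t\mathcal{P}=\{tx: x\in\mathcal{P}\}$, and Macdonald's solid-angle sum is $A_{\mathcal{P}}(t)=\sum_{x\in\mathbb{Z}^2}\omega_{t\mathcal{P}}(x)$. The function $B_1(x)$ equals $x-\tfrac12$ for $x\in(0,1)$ and $0$ otherwise; $B_2(x)$ equals $x^2-x+\tfrac16$ for $x\in[0,1]$ and $0$ otherwise; $\bar{B}_j(x):=B_j(x-\lfloor x\rfloor)$ for $j=1,2$ (so $\bar B_1$ vanishes at integers). The Dedekind–Rademacher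 sum is $s(h,k;y,x)=\sum_{r \bmod k}\bar{B}_1\!\left(h\frac{r+x}{k}+y\right)\bar{B}_1\!\left(\frac{r+x}{k}\right)$ for coprime positive integers $h,k$ and real $x,y$. $\mathbf{1}_{\mathbb{Z}}$ is the indicator function of the integers. *)

theory Defs
  imports "HOL-Analysis.Analysis"
begin

definition angle_between :: "real \<times> real \<Rightarrow> real \<times> real \<Rightarrow> real" where
  "angle_between u v = arccos (inner u v / (norm u * norm v))"

text \<open>
  The solid angle is defined for convex polygons, whose vertices and edges are their extreme
  points and one-dimensional faces. Exactly two edges meet at a vertex of such a polygon, and the
  interior angle is the angle between them.
\<close>

definition interior_angle :: "(real \<times> real) set \<Rightarrow> real \<times> real \<Rightarrow> real" where
  "interior_angle P x =
     (THE \<theta>. \<exists>a b. a \<noteq> b \<and> closed_segment x a edge_of P \<and> closed_segment x b edge_of P \<and>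
                \<theta> = angle_between (a - x) (b - x))"

definition solid_angle :: "(real \<times> real) set \<Rightarrow> real \<times> real \<Rightarrow> real" where
  "solid_angle P x =
     (if x \<in> interior P then 1
      else if x \<notin> P then 0
      else if \<exists>e. e edge_of P \<and> x \<in> rel_interior e then 1 / 2
      else if x extreme_point_of P then interior_angle P x / (2 * pi)
      else 0)"

text \<open>The sum has only finitely many nonzero terms, since polygons are bounded.\<close>

definition solid_angle_sum :: "(real \<times> real) set \<Rightarrow> real \<Rightarrow> real" where
  "solid_angle_sum P t = (\<Sum>\<^sub>\<infinity>x \<in> \<int> \<times> \<int>. solid_angle ((*\<^sub>R) t ` P) x)"

definition B1 :: "real \<Rightarrow> real" where
  "B1 x = (if x \<in> {0<..<1} then x - 1 / 2 else 0)"

definition B2 :: "real \<Rightarrow> real" where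
  "B2 x = (if x \<in> {0..1} then x\<^sup>2 - x + 1 / 6 else 0)"

definition B1_bar :: "real \<Rightarrow> real" where
  "B1_bar x = B1 (x - of_int \<lfloor>x\<rfloor>)"

definition B2_bar :: "real \<Rightarrow> real" where
  "B2_bar x = B2 (x - of_int \<lfloor>x\<rfloor>)"

text \<open>The summand is \<open>k\<close>-periodic in \<open>r\<close>; we sum over the residues \<open>0, \<dots>, k - 1\<close>.\<close>

definition dedekind_rademacher_sum :: "nat \<Rightarrow> nat \<Rightarrow> real \<Rightarrow> real \<Rightarrow> real" where
  "dedekind_rademacher_sum h k y x =
     (\<Sum>r<k. B1_bar (real h * ((real r + x) / real k) + y) * B1_bar ((real r + x) / real k))"

end

theory Submission
  imports Defs "HOL-Number_Theory.Modular_Inverse"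
begin

text \<open>
  The sum is even in \<open>t\<close>, so let \<open>t > 0\<close>. Let \<open>H\<close> be the step function with \<open>H 0 = 1/2\<close>. Apart from the
  two acute vertices, where the defect is an arctangent, the solid angle of the dilated triangle at
  \<open>(m, n)\<close> is \<open>H x \<cdot> H y \<cdot> H (t - x - y)\<close> with \<open>x = m/h\<close> and \<open>y = n/k\<close>. The points \<open>(x, y)\<close> form
  the translates of \<open>\<int>\<^sup>2\<close> by the \<open>h k\<close> grid points \<open>(u, v)\<close> with \<open>u \<in> \<int>/h\<close>, \<open>v \<in> \<int>/k\<close> and \<open>0 \<le> u, v < 1\<close>.

  Put \<open>w = t - u - v\<close>. If none of \<open>u\<close>, \<open>v\<close>, \<open>w\<close> is an integer, then the translate by \<open>(u, v)\<close> contributes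
  the triangular number \<open>(\<lfloor>w\<rfloor> + 1) (\<lfloor>w\<rfloor> + 2) / 2 = ((\<lfloor>w\<rfloor> + 3/2)\<^sup>2 - 1/4) / 2\<close>. Here
  \<open>\<lfloor>w\<rfloor> + 3/2 = t - B\<^sub>1 u - B\<^sub>1 v - B\<^sub>1 w\<close>, and \<open>- 1/4\<close> turns the three squares \<open>B\<^sub>1\<^sup>2\<close> into
  \<open>B\<^sub>1\<^sup>2 - 1/12 = B\<^sub>2\<close>; written with \<open>B\<^sub>2\<close>, the formula persists at integers because of the
  weights \<open>1/2\<close>. Summing over \<open>(u, v)\<close>, the multiplication theorems for \<open>B\<^sub>1\<close> and \<open>B\<^sub>2\<close> evaluate
  the linear and square terms, and the products \<open>B\<^sub>1 u \<cdot> B\<^sub>1 w\<close> and \<open>B\<^sub>1 v \<cdot> B\<^sub>1 w\<close> give the two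
  Dedekind-Rademacher sums.
\<close>

section \<open>Periodic Bernoulli functions\<close>

lemma B1_bar_between_ints:
  assumes "of_int n < x" "x < of_int n + 1"
  shows "B1_bar x = x - of_int n - 1 / 2"
proof -
  have "\<lfloor>x\<rfloor> = n" using assms by (intro floor_unique) auto
  then show ?thesis using assms by (simp add: B1_bar_def B1_def)
qed

lemma B2_bar_between_ints:
  assumes "of_int n \<le> x" "x \<le> of_int n + 1"
  shows "B2_bar x = (x - of_int n)\<^sup>2 - (x - of_int n) + 1 / 6"
proof (cases "x = of_int n + 1")
  case False
  then have "\<lfloor>x\<rfloor> = n" using assms by (intro floor_unique) auto
  then show ?thesis using assms by (simp add: B2_bar_def B2_def)
qed (simp add: B2_bar_def B2_def)

lemma B1_bar_Ints [simp]: "x \<in> \<int> \<Longrightarrow> B1_bar x = 0"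
  by (auto simp: B1_bar_def B1_def elim: Ints_cases)

lemma B1_bar_Ico: "0 \<le> x \<Longrightarrow> x < 1 \<Longrightarrow> B1_bar x = x - 1 / 2 + (if x = 0 then 1 / 2 else 0)"
  using B1_bar_between_ints[of 0 x] by auto

lemma B2_bar_Icc: "0 \<le> x \<Longrightarrow> x \<le> 1 \<Longrightarrow> B2_bar x = x\<^sup>2 - x + 1 / 6"
  using B2_bar_between_ints[of 0 x] by simp

interpretation B1_bar: periodic_fun_simple' B1_bar
  by standard (simp add: B1_bar_def)

interpretation B2_bar: periodic_fun_simple' B2_bar
  by standard (simp add: B2_bar_def)

lemma B1_bar_minus [simp]: "B1_bar (- x) = - B1_bar x"
proof (cases "x \<in> \<int>")
  case False
  then have "of_int \<lfloor>x\<rfloor> < x" "x < of_int \<lfloor>x\<rfloor> + 1"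
    using frac_gt_0_iff[of x] by (simp_all add: frac_def)
  then have "B1_bar x = x - of_int \<lfloor>x\<rfloor> - 1 / 2" "B1_bar (- x) = - x - of_int (- \<lfloor>x\<rfloor> - 1) - 1 / 2"
    by (intro B1_bar_between_ints; simp; linarith)+
  then show ?thesis by simp
qed simp

lemma B2_bar_minus [simp]: "B2_bar (- x) = B2_bar x"
proof -
  have "of_int \<lfloor>x\<rfloor> \<le> x" "x \<le> of_int \<lfloor>x\<rfloor> + 1" by linarith+
  then show ?thesis
    using B2_bar_between_ints[of "\<lfloor>x\<rfloor>" x] B2_bar_between_ints[of "- \<lfloor>x\<rfloor> - 1" "- x"]
    by (simp add: power2_eq_square algebra_simps)
qed

lemma periodic_eqI:
  fixes f g :: "real \<Rightarrow> 'a"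
  assumes "periodic_fun_simple' f" "periodic_fun_simple' g"
    and unit: "\<And>x. 0 \<le> x \<Longrightarrow> x < 1 \<Longrightarrow> f x = g x"
  shows "f x = g x"
proof -
  interpret f: periodic_fun_simple' f by fact
  interpret g: periodic_fun_simple' g by fact
  have "f (frac x) = g (frac x)" by (intro unit frac_ge_0 frac_lt_1)
  then show ?thesis
    using f.plus_of_int[of "frac x" "\<lfloor>x\<rfloor>"] g.plus_of_int[of "frac x" "\<lfloor>x\<rfloor>"]
    by (simp add: frac_def)
qed

lemma periodic_sum_equidistant:
  fixes f :: "real \<Rightarrow> 'a::ab_group_add"
  assumes "periodic_fun_simple' f"
  shows "periodic_fun_simple' (\<lambda>x. \<Sum>r<n. f ((x + real r) / real n))"
proof
  interpret f: periodic_fun_simple' f by fact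
  fix x
  have "(\<Sum>r<n. f ((x + 1 + real r) / real n)) - (\<Sum>r<n. f ((x + real r) / real n))
      = (\<Sum>r<n. f ((x + real (Suc r)) / real n) - f ((x + real r) / real n))"
    by (simp add: sum_subtractf add_ac)
  also have "\<dots> = f ((x + real n) / real n) - f ((x + real 0) / real n)"
    by (rule sum_lessThan_telescope)
  also have "\<dots> = 0"
    by (cases "n = 0") (simp_all add: add_divide_distrib f.plus_1)
  finally show "(\<Sum>r<n. f ((x + 1 + real r) / real n)) = (\<Sum>r<n. f ((x + real r) / real n))"
    by simp
qed

lemma sum_periodic_coprime_mult:
  fixes f :: "real \<Rightarrow> 'a::comm_monoid_add"
  assumes "periodic_fun_simple' f" and coprime: "coprime a (int n)"
  shows "(\<Sum>r<n. f (of_int a * real r / real n)) = (\<Sum>r<n. f (real r / real n))"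
proof (cases "n = 0")
  case False
  interpret f: periodic_fun_simple' f by fact
  have residues: "(\<Sum>r<n. g (real r)) = g 0 + (\<Sum>m\<in>{1..<int n}. g (of_int m))"
    for g :: "real \<Rightarrow> 'a"
  proof -
    have "(\<Sum>r<n. g (real r)) = (\<Sum>m\<in>int ` {..<n}. g (of_int m))"
      by (simp add: sum.reindex)
    also have "int ` {..<n} = insert 0 {1..<int n}"
      using False by (auto simp: lessThan_atLeast0 image_int_atLeastLessThan)
    finally show ?thesis by simp
  qed
  have "f (of_int (a * m mod int n) / real n) = f (of_int a * of_int m / real n)" for m
  proof -
    have "real_of_int (a * m mod int n) = of_int a * of_int m - real n * of_int (a * m div int n)"
      by (simp flip: minus_mult_div_eq_mod)
    then have "of_int a * of_int m / real n
        = of_int (a * m mod int n) / real n + of_int (a * m div int n)"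
      using False by (simp add: field_simps)
    then show ?thesis by (simp only: f.plus_of_int)
  qed
  then have "(\<Sum>m\<in>{1..<int n}. f (of_int a * of_int m / real n))
      = (\<Sum>m\<in>{1..<int n}. f (of_int m / real n))"
    using sum.reindex_bij_betw[OF bij_betw_int_remainders_mult[OF coprime],
        of "\<lambda>m. f (of_int m / real n)"] by simp
  then show ?thesis
    by (simp add: residues[of "\<lambda>x. f (of_int a * x / real n)"] residues[of "\<lambda>x. f (x / real n)"])
qed simp

lemma sum_add_of_nat:
  "(\<Sum>r<n. x + of_nat r) = of_nat n * (2 * x + of_nat n - 1) / (2 :: 'a::field_char_0)"
  by (induction n) (simp_all add: field_simps)

lemma sum_add_of_nat_squared:
  "(\<Sum>r<n. (x + of_nat r)\<^sup>2)
    = of_nat n * (6 * x\<^sup>2 + 6 * x * (of_nat n - 1) + (of_nat n - 1) * (2 * of_nat n - 1))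
      / (6 :: 'a::field_char_0)"
  by (induction n) (simp_all add: field_simps power2_eq_square)

lemma B1_bar_multiplication:
  assumes "0 < n"
  shows "(\<Sum>r<n. B1_bar ((x + real r) / real n)) = B1_bar x"
proof (rule periodic_eqI[OF periodic_sum_equidistant])
  fix x :: real
  assume x: "0 \<le> x" "x < 1"
  have "(x + real r) / real n < 1" if "r < n" for r
  proof -
    have "real r \<le> real n - 1" using that by linarith
    then show ?thesis using x assms by simp
  qed
  then have "(\<Sum>r<n. B1_bar ((x + real r) / real n))
      = (\<Sum>r<n. (x + real r) / real n - 1 / 2 + (if r = 0 then if x = 0 then 1 / 2 else 0 else 0))"
    using x assms by (intro sum.cong refl) (auto simp: B1_bar_Ico add_nonneg_eq_0_iff)
  also have "\<dots> = (\<Sum>r<n. (x + real r) / real n - 1 / 2) + (if x = 0 then 1 / 2 else 0)"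
    using assms by (simp add: sum.distrib)
  also have "(\<Sum>r<n. (x + real r) / real n - 1 / 2) = (\<Sum>r<n. x + real r) / real n - real n / 2"
    by (simp add: sum_subtractf flip: sum_divide_distrib)
  also have "\<dots> = x - 1 / 2"
    unfolding sum_add_of_nat using assms by (simp add: field_simps)
  finally show "(\<Sum>r<n. B1_bar ((x + real r) / real n)) = B1_bar x"
    using x by (simp add: B1_bar_Ico)
qed (rule B1_bar.periodic_fun_simple'_axioms)+

lemma B2_bar_multiplication:
  assumes "0 < n"
  shows "(\<Sum>r<n. B2_bar ((x + real r) / real n)) = B2_bar x / real n"
proof (rule periodic_eqI[OF periodic_sum_equidistant])
  show "periodic_fun_simple' (\<lambda>x. B2_bar x / real n)"
    by standard (simp add: B2_bar.plus_1)
next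
  fix x :: real
  assume x: "0 \<le> x" "x < 1"
  have "(x + real r) / real n \<le> 1" if "r < n" for r
  proof -
    have "real r \<le> real n - 1" using that by linarith
    then show ?thesis using x assms by simp
  qed
  then have "(\<Sum>r<n. B2_bar ((x + real r) / real n))
      = (\<Sum>r<n. ((x + real r) / real n)\<^sup>2 - (x + real r) / real n + 1 / 6)"
    using x by (intro sum.cong refl B2_bar_Icc) auto
  also have "\<dots> = (\<Sum>r<n. (x + real r)\<^sup>2) / (real n)\<^sup>2 - (\<Sum>r<n. x + real r) / real n + real n / 6"
    by (simp add: sum.distrib sum_subtractf power_divide flip: sum_divide_distrib)
  also have "\<dots> = (x\<^sup>2 - x + 1 / 6) / real n"
    unfolding sum_add_of_nat sum_add_of_nat_squared
    using assms by (simp add: field_simps power2_eq_square)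
  finally show "(\<Sum>r<n. B2_bar ((x + real r) / real n)) = B2_bar x / real n"
    using x by (simp add: B2_bar_Icc)
qed (rule B2_bar.periodic_fun_simple'_axioms)

lemma sum_B1_bar_fractions: "(\<Sum>r<n. B1_bar (real r / real n)) = 0"
  using B1_bar_multiplication[of n 0] by (cases "n = 0") simp_all

lemma sum_B2_bar_fractions: "(\<Sum>r<n. B2_bar (real r / real n)) = 1 / (6 * real n)"
  using B2_bar_multiplication[of n 0] by (cases "n = 0") (simp_all add: B2_bar_Icc)

section \<open>Weighted lattice points in a right triangle\<close>

definition heaviside :: "real \<Rightarrow> real" where
  "heaviside x = (1 + sgn x) / 2"

lemma heaviside_simps [simp]:
  "x < 0 \<Longrightarrow> heaviside x = 0" "heaviside 0 = 1 / 2" "0 < x \<Longrightarrow> heaviside x = 1"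
  by (simp_all add: heaviside_def)

lemma sum_heaviside:
  assumes "- 1 < w" "w < real N"
  shows "(\<Sum>n<N. heaviside (w - real n)) = w - B1_bar w + 1 / 2"
  using assms
proof (induction N arbitrary: w)
  case 0
  then show ?case using B1_bar_between_ints[of "- 1" w] by simp
next
  case (Suc N)
  have peel: "(\<Sum>n<Suc N. heaviside (w - real n)) = heaviside w + (\<Sum>n<N. heaviside (w - 1 - real n))"
    by (simp only: sum.lessThan_Suc_shift) (simp add: diff_diff_eq)
  consider (negative) "w < 0" | (zero) "w = 0" | (positive) "0 < w" by linarith
  then show ?case
  proof cases
    case negative
    then show ?thesis using B1_bar_between_ints[of "- 1" w] Suc.prems by simp
  next
    case zero
    then show ?thesis unfolding peel by simp
  next
    case positive
    then show ?thesis
      using Suc.IH[of "w - 1"] Suc.prems B1_bar.minus_1[of w] unfolding peel by simp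
  qed
qed

lemma quadratic_B_bar_Ioo:
  assumes "- 2 < w" "w < 0"
  shows "(w + 1)\<^sup>2 - 2 * (w + 1) * B1_bar w + B2_bar w = 1 / 6"
proof -
  consider (left) "w < - 1" | (middle) "w = - 1" | (right) "- 1 < w" by linarith
  then show ?thesis
  proof cases
    case left
    then show ?thesis
      using assms B1_bar_between_ints[of "- 2" w] B2_bar_between_ints[of "- 2" w]
      by (simp add: power2_eq_square algebra_simps)
  next
    case middle
    then show ?thesis using B2_bar_between_ints[of "- 1" w] by simp
  next
    case right
    then show ?thesis
      using assms B1_bar_between_ints[of "- 1" w] B2_bar_between_ints[of "- 1" w]
      by (simp add: power2_eq_square algebra_simps)
  qed
qed

lemma sum_sum_heaviside:
  assumes "- 2 < w" "w < real M" "M \<le> N"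
  shows "(\<Sum>m<M. \<Sum>n<N. heaviside (w - real m - real n))
    = ((w + 1)\<^sup>2 - 2 * (w + 1) * B1_bar w + B2_bar w - 1 / 6) / 2"
  using assms
proof (induction M arbitrary: w)
  case 0
  then show ?case by (subst quadratic_B_bar_Ioo) simp_all
next
  case (Suc M)
  show ?case
  proof (cases "w < 0")
    case True
    then show ?thesis using Suc.prems by (subst quadratic_B_bar_Ioo) simp_all
  next
    case False
    have "(\<Sum>m<Suc M. \<Sum>n<N. heaviside (w - real m - real n))
        = (\<Sum>n<N. heaviside (w - real n)) + (\<Sum>m<M. \<Sum>n<N. heaviside (w - 1 - real m - real n))"
      by (simp only: sum.lessThan_Suc_shift) (simp add: diff_diff_eq)
    then show ?thesis
      using False Suc.IH[of "w - 1"] Suc.prems sum_heaviside[of w N]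
        B1_bar.minus_1[of w] B2_bar.minus_1[of w]
      by (simp add: field_simps power2_eq_square)
  qed
qed

lemma sum_heaviside_weighted:
  assumes "0 \<le> u"
  shows "(\<Sum>n<Suc N. heaviside (u + real n) * f n) = (\<Sum>n<Suc N. f n) - (1 - heaviside u) * f 0"
proof -
  have "heaviside (u + real (Suc n)) = 1" for n using assms by simp
  then show ?thesis
    unfolding sum.lessThan_Suc_shift by (simp add: algebra_simps)
qed

lemma sum_lessThan_mult:
  fixes f :: "nat \<Rightarrow> 'a::comm_monoid_add"
  shows "(\<Sum>m<h * N. f m) = (\<Sum>i<h. \<Sum>m<N. f (i + h * m))"
proof -
  have "(\<Sum>m\<in>{q * h..<q * h + h}. f m) = (\<Sum>i<h. f (i + h * q))" for q
    using sum.shift_bounds_nat_ivl[of f 0 "q * h" h] by (simp add: lessThan_atLeast0 ac_simps)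
  then have "(\<Sum>m<h * N. f m) = (\<Sum>m<N. \<Sum>i<h. f (i + h * m))"
    using sum.nat_group[of f h N] by (simp add: mult.commute)
  also have "\<dots> = (\<Sum>i<h. \<Sum>m<N. f (i + h * m))"
    by (rule sum.swap)
  finally show ?thesis .
qed

definition triangle_weight :: "real \<Rightarrow> real \<Rightarrow> real \<Rightarrow> real" where
  "triangle_weight t x y = heaviside x * heaviside y * heaviside (t - x - y)"

lemma triangle_weight_scale:
  assumes "0 < c"
  shows "triangle_weight (c * t) (c * x) (c * y) = triangle_weight t x y"
proof -
  have "heaviside (c * z) = heaviside z" for z
    using assms by (simp add: heaviside_def sgn_mult)
  then show ?thesis
    by (simp add: triangle_weight_def flip: right_diff_distrib)
qed

text \<open>
  This is \<open>(t - B1_bar u - B1_bar v - B1_bar (t - u - v))\<^sup>2 / 2\<close> with each \<open>(B1_bar x)\<^sup>2\<close> replaced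
  by \<open>B2_bar x\<close>.
\<close>

definition translate_count :: "real \<Rightarrow> real \<Rightarrow> real \<Rightarrow> real" where
  "translate_count t u v = (t\<^sup>2 + B2_bar u + B2_bar v + B2_bar (u + v - t)) / 2
     - t * (B1_bar u + B1_bar v - B1_bar (u + v - t))
     + B1_bar u * B1_bar v - (B1_bar u + B1_bar v) * B1_bar (u + v - t)"

lemma sum_triangle_weight_translate:
  assumes u_bounds: "0 \<le> u" "u < 1" and v_bounds: "0 \<le> v" "v < 1" and t_bounds: "0 < t" "t < real N"
  shows "(\<Sum>m<N. \<Sum>n<N. triangle_weight t (u + real m) (v + real n)) = translate_count t u v"
proof -
  define w where "w = t - u - v"
  obtain M where N_Suc: "N = Suc M" using t_bounds by (cases N) auto
  have w_bounds: "- 2 < w" "w < real N" using u_bounds v_bounds t_bounds by (simp_all add: w_def)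
  have "(\<Sum>m<N. \<Sum>n<N. triangle_weight t (u + real m) (v + real n))
    = (\<Sum>m<N. heaviside (u + real m)
        * (\<Sum>n<N. heaviside (v + real n) * heaviside (w - real m - real n)))"
    by (simp add: triangle_weight_def w_def sum_distrib_left algebra_simps)
  also have "\<dots> = (\<Sum>m<N. \<Sum>n<N. heaviside (w - real m - real n))
      - (1 - heaviside v) * (\<Sum>m<N. heaviside (w - real m))
      - (1 - heaviside u) * (\<Sum>n<N. heaviside (w - real n))
      + (1 - heaviside u) * (1 - heaviside v) * heaviside w"
    unfolding N_Suc sum_heaviside_weighted[OF v_bounds(1)] sum_heaviside_weighted[OF u_bounds(1)]
    by (simp only: sum_subtractf sum_distrib_left[symmetric]) (simp add: algebra_simps)
  also have "\<dots> = (t\<^sup>2 + B2_bar u + B2_bar v + B2_bar w) / 2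
      - t * (B1_bar u + B1_bar v + B1_bar w)
      + B1_bar u * B1_bar v + (B1_bar u + B1_bar v) * B1_bar w"
  proof -
    have row: "(\<Sum>n<N. heaviside (w - real n)) = w - B1_bar w + 1 / 2" if "u = 0 \<or> v = 0"
      using that u_bounds v_bounds t_bounds w_bounds
      by (intro sum_heaviside) (auto simp: w_def)
    have "t = u + v + w" by (simp add: w_def)
    then show ?thesis
      unfolding sum_sum_heaviside[OF w_bounds order_refl] using u_bounds v_bounds t_bounds row
      by (cases "u = 0"; cases "v = 0")
        (simp_all add: B1_bar_Ico B2_bar_Icc power2_eq_square field_simps)
  qed
  also have "w = - (u + v - t)" by (simp add: w_def)
  finally show ?thesis
    unfolding B1_bar_minus B2_bar_minus by (simp add: translate_count_def)
qed

lemma sum_triangle_weight_lattice: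
  assumes "0 < h" "0 < k" "0 < t" "t < real N"
  shows "(\<Sum>m<h * N. \<Sum>n<k * N. triangle_weight t (real m / real h) (real n / real k))
    = (\<Sum>i<h. \<Sum>j<k. translate_count t (real i / real h) (real j / real k))"
proof -
  have "(\<Sum>m<h * N. \<Sum>n<k * N. triangle_weight t (real m / real h) (real n / real k))
      = (\<Sum>i<h. \<Sum>j<k. \<Sum>m<N. \<Sum>n<N.
          triangle_weight t (real i / real h + real m) (real j / real k + real n))"
    using assms(1,2)
    by (simp add: sum_lessThan_mult sum.swap[of _ "{..<k}" "{..<N}"] add_divide_distrib)
  also have "\<dots> = (\<Sum>i<h. \<Sum>j<k. translate_count t (real i / real h) (real j / real k))"
    using assms by (intro sum.cong refl sum_triangle_weight_translate) auto
  finally show ?thesis .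
qed

section \<open>Summing over the residue classes\<close>

lemma sum_grid_coprime:
  fixes f :: "real \<Rightarrow> real" and c :: "nat \<Rightarrow> real"
  assumes "periodic_fun_simple' f"
    and multiplication: "\<And>n x. 0 < n \<Longrightarrow> (\<Sum>r<n. f ((x + real r) / real n)) = c n * f x"
    and "0 < h" "0 < k" "coprime h k"
  shows "(\<Sum>i<h. \<Sum>j<k. f (real i / real h + real j / real k + x))
    = c h * c k * f (real h * real k * x)"
proof -
  interpret f: periodic_fun_simple' f by fact
  have "(\<Sum>i<h. \<Sum>j<k. f (real i / real h + real j / real k + x))
      = (\<Sum>i<h. \<Sum>j<k. f ((of_int (int k) * real i / real h + real k * x + real j) / real k))"
    using \<open>0 < k\<close> by (simp add: add_divide_distrib add_ac)
  also have "\<dots> = c k * (\<Sum>i<h. f (of_int (int k) * real i / real h + real k * x))"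
    by (simp only: multiplication \<open>0 < k\<close> sum_distrib_left)
  also have "(\<Sum>i<h. f (of_int (int k) * real i / real h + real k * x))
      = (\<Sum>i<h. f (real i / real h + real k * x))"
  proof (rule sum_periodic_coprime_mult[where f = "\<lambda>y. f (y + real k * x)"])
    show "periodic_fun_simple' (\<lambda>y. f (y + real k * x))"
    proof
      show "f (y + 1 + real k * x) = f (y + real k * x)" for y
        using f.plus_1[of "y + real k * x"] by (simp add: add_ac)
    qed
  qed (use \<open>coprime h k\<close> in \<open>simp add: coprime_commute\<close>)
  also have "\<dots> = (\<Sum>i<h. f ((real h * real k * x + real i) / real h))"
    using \<open>0 < h\<close> by (simp add: add_divide_distrib add.commute)
  also have "\<dots> = c h * f (real h * real k * x)"
    by (rule multiplication) fact
  finally show ?thesis by simp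
qed

lemma dedekind_rademacher_sum_minus:
  "dedekind_rademacher_sum h k (- y) 0 = dedekind_rademacher_sum h k y 0"
proof -
  define f where "f x = B1_bar (real h * x - y) * B1_bar x" for x
  have "periodic_fun_simple' f"
  proof
    show "f (x + 1) = f x" for x
      using B1_bar.plus_of_nat[of "real h * x - y" h] B1_bar.plus_1[of x]
      by (simp add: f_def algebra_simps)
  qed
  then have "(\<Sum>r<k. f (real r / real k)) = (\<Sum>r<k. f (of_int (- 1) * real r / real k))"
    by (subst sum_periodic_coprime_mult) auto
  moreover have "f (- x) = B1_bar (real h * x + y) * B1_bar x" for x
    using B1_bar_minus[of "real h * x + y"] by (simp add: f_def)
  then have "f (of_int (- 1) * real r / real k)
      = B1_bar (real h * (real r / real k) + y) * B1_bar (real r / real k)" for r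
    by (simp only: of_int_minus of_int_1 mult_minus1 minus_divide_left[symmetric])
  ultimately show ?thesis
    by (simp add: dedekind_rademacher_sum_def f_def)
qed

lemma sum_grid_B1_bar_mult_B1_bar:
  assumes "0 < k"
  shows "(\<Sum>i<h. \<Sum>j<k. B1_bar (real i / real h) * B1_bar (real i / real h + real j / real k - t))
    = dedekind_rademacher_sum k h (real k * t) 0"
proof -
  have "(\<Sum>j<k. B1_bar (u + real j / real k - t)) = B1_bar (real k * u - real k * t)" for u
    using B1_bar_multiplication[OF assms, of "real k * (u - t)"] assms
    by (simp add: add_divide_distrib diff_divide_distrib algebra_simps)
  then have "(\<Sum>i<h. \<Sum>j<k. B1_bar (real i / real h) * B1_bar (real i / real h + real j / real k - t))
      = dedekind_rademacher_sum k h (- (real k * t)) 0"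
    by (simp add: dedekind_rademacher_sum_def mult.commute flip: sum_distrib_left)
  then show ?thesis by (simp only: dedekind_rademacher_sum_minus)
qed

lemma sum_grid_B1_bar:
  assumes "0 < h" "0 < k" "coprime h k"
  shows "(\<Sum>i<h. \<Sum>j<k. B1_bar (real i / real h + real j / real k - t))
    = - B1_bar (real h * real k * t)"
  using sum_grid_coprime[OF B1_bar.periodic_fun_simple'_axioms, of "\<lambda>_. 1" h k "- t"]
    B1_bar_multiplication assms by simp

lemma sum_grid_B2_bar:
  assumes "0 < h" "0 < k" "coprime h k"
  shows "(\<Sum>i<h. \<Sum>j<k. B2_bar (real i / real h + real j / real k - t))
    = B2_bar (real h * real k * t) / (real h * real k)"
  using sum_grid_coprime[OF B2_bar.periodic_fun_simple'_axioms, of "\<lambda>n. 1 / real n" h k "- t"]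
    B2_bar_multiplication assms by simp

lemma sum_grid_translate_count:
  assumes "0 < h" "0 < k" "coprime h k"
  shows "(\<Sum>i<h. \<Sum>j<k. translate_count t (real i / real h) (real j / real k))
    = real h * real k / 2 * t\<^sup>2 - B1_bar (real h * real k * t) * t
      + 1 / (2 * real h * real k)
          * (B2_bar (real h * real k * t) + ((real h)\<^sup>2 + (real k)\<^sup>2) / 6)
      - dedekind_rademacher_sum h k (real h * t) 0
      - dedekind_rademacher_sum k h (real k * t) 0" (is "_ = ?formula")
proof -
  define u v where "u i = real i / real h" and "v j = real j / real k" for i j
  have evaluations:
    "(\<Sum>i<h. B1_bar (u i)) = 0" "(\<Sum>j<k. B1_bar (v j)) = 0"
    "(\<Sum>i<h. B2_bar (u i)) = 1 / (6 * real h)" "(\<Sum>j<k. B2_bar (v j)) = 1 / (6 * real k)"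
    "(\<Sum>i<h. \<Sum>j<k. B1_bar (u i + v j - t)) = - B1_bar (real h * real k * t)"
    "(\<Sum>i<h. \<Sum>j<k. B2_bar (u i + v j - t)) = B2_bar (real h * real k * t) / (real h * real k)"
    unfolding u_def v_def
    by (rule sum_B1_bar_fractions sum_B2_bar_fractions
        sum_grid_B1_bar[OF assms] sum_grid_B2_bar[OF assms])+
  have "(\<Sum>i<h. \<Sum>j<k. translate_count t (u i) (v j))
    = (real h * real k * t\<^sup>2 + real k * (\<Sum>i<h. B2_bar (u i)) + real h * (\<Sum>j<k. B2_bar (v j))
        + (\<Sum>i<h. \<Sum>j<k. B2_bar (u i + v j - t))) / 2
      - t * (real k * (\<Sum>i<h. B1_bar (u i)) + real h * (\<Sum>j<k. B1_bar (v j))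
        - (\<Sum>i<h. \<Sum>j<k. B1_bar (u i + v j - t)))
      + (\<Sum>i<h. B1_bar (u i)) * (\<Sum>j<k. B1_bar (v j))
      - (\<Sum>i<h. \<Sum>j<k. B1_bar (u i) * B1_bar (u i + v j - t))
      - (\<Sum>i<h. \<Sum>j<k. B1_bar (v j) * B1_bar (u i + v j - t))"
    by (simp add: translate_count_def sum_product sum.distrib sum_subtractf algebra_simps
        add_divide_distrib flip: sum_distrib_left sum_divide_distrib)
  also have "(\<Sum>i<h. \<Sum>j<k. B1_bar (u i) * B1_bar (u i + v j - t))
      = dedekind_rademacher_sum k h (real k * t) 0"
    unfolding u_def v_def by (rule sum_grid_B1_bar_mult_B1_bar[OF assms(2)])
  also have "(\<Sum>i<h. \<Sum>j<k. B1_bar (v j) * B1_bar (u i + v j - t))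
      = dedekind_rademacher_sum h k (real h * t) 0"
    using sum_grid_B1_bar_mult_B1_bar[OF assms(1), of k t]
    by (subst sum.swap) (simp add: u_def v_def add.commute)
  finally have "(\<Sum>i<h. \<Sum>j<k. translate_count t (u i) (v j)) = ?formula"
    unfolding evaluations using assms(1,2) by (simp add: field_simps power2_eq_square)
  then show ?thesis by (simp only: u_def v_def)
qed

section \<open>Solid angles\<close>

lemma edge_of_linear_image:
  assumes "linear f" "inj f"
  shows "f ` e edge_of f ` S \<longleftrightarrow> e edge_of S"
  using assms by (simp add: edge_of_def face_of_linear_image aff_dim_injective_linear_image)

lemma extreme_point_of_linear_image:
  assumes "linear f" "inj f"
  shows "f x extreme_point_of f ` S \<longleftrightarrow> x extreme_point_of S"
  using face_of_linear_image[OF assms, of "{x}" S] by (simp add: face_of_singleton)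

lemma mem_rel_interior_edge_of_linear_image:
  fixes f :: "'a::euclidean_space \<Rightarrow> 'b::euclidean_space"
  assumes "linear f" "inj f"
  shows "(\<exists>e. e edge_of f ` S \<and> f x \<in> rel_interior e) \<longleftrightarrow> (\<exists>e. e edge_of S \<and> x \<in> rel_interior e)"
proof -
  have rel_interior: "f x \<in> rel_interior (f ` e) \<longleftrightarrow> x \<in> rel_interior e" for e
    using assms by (simp add: rel_interior_injective_linear_image linear_linear inj_image_mem_iff)
  have "\<exists>e'. e = f ` e'" if "e edge_of f ` S" for e
    using edge_of_imp_subset[OF that] by (simp add: subset_image_iff) blast
  then show ?thesis
    using rel_interior edge_of_linear_image[OF assms] by metis
qed

lemma angle_between_orthogonal_transformation:
  assumes "orthogonal_transformation f"
  shows "angle_between (f u) (f v) = angle_between u v"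
proof -
  have "inner (f u) (f v) = inner u v"
    using assms unfolding orthogonal_transformation_def by blast
  then show ?thesis
    by (simp only: angle_between_def orthogonal_transformation_norm[OF assms])
qed

lemma interior_angle_orthogonal_transformation:
  assumes orthogonal: "orthogonal_transformation f"
  shows "interior_angle (f ` P) (f x) = interior_angle P x"
proof -
  note linear = orthogonal_transformation_linear[OF orthogonal]
    and inj = orthogonal_transformation_inj[OF orthogonal]
  have edge: "closed_segment (f x) (f a) edge_of f ` P \<longleftrightarrow> closed_segment x a edge_of P" for a
    by (simp only: closed_segment_linear_image[OF linear] edge_of_linear_image[OF linear inj])
  have angle: "angle_between (f a - f x) (f b - f x) = angle_between (a - x) (b - x)" for a b
    by (simp only: angle_between_orthogonal_transformation[OF orthogonal] flip: linear_diff[OF linear])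
  have "(\<exists>a b. a \<noteq> b \<and> closed_segment (f x) a edge_of f ` P \<and> closed_segment (f x) b edge_of f ` P
      \<and> \<theta> = angle_between (a - f x) (b - f x))
    \<longleftrightarrow> (\<exists>a b. a \<noteq> b \<and> closed_segment x a edge_of P \<and> closed_segment x b edge_of P
      \<and> \<theta> = angle_between (a - x) (b - x))" for \<theta>
    using surjD[OF orthogonal_transformation_surj[OF orthogonal]] edge angle inj_eq[OF inj] by metis
  then show ?thesis by (simp only: interior_angle_def)
qed

lemma solid_angle_orthogonal_transformation:
  assumes orthogonal: "orthogonal_transformation f"
  shows "solid_angle (f ` P) (f x) = solid_angle P x"
proof -
  note linear = orthogonal_transformation_linear[OF orthogonal]
    and inj = orthogonal_transformation_inj[OF orthogonal]
  show ?thesis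
    unfolding solid_angle_def interior_injective_linear_image[OF linear inj] inj_image_mem_iff[OF inj]
      mem_rel_interior_edge_of_linear_image[OF linear inj] extreme_point_of_linear_image[OF linear inj]
      interior_angle_orthogonal_transformation[OF orthogonal] ..
qed

lemma solid_angle_sum_minus: "solid_angle_sum P (- t) = solid_angle_sum P t"
proof -
  have "orthogonal_transformation (uminus :: real \<times> real \<Rightarrow> _)"
    using orthogonal_transformation_neg[of "\<lambda>x. x"] by simp
  then have "solid_angle (uminus ` (*\<^sub>R) t ` P) (- (- x)) = solid_angle ((*\<^sub>R) t ` P) (- x)" for x
    by (rule solid_angle_orthogonal_transformation)
  moreover have "uminus ` (*\<^sub>R) t ` P = (*\<^sub>R) (- t) ` P"
    by (simp add: image_image)
  ultimately have reflect: "solid_angle ((*\<^sub>R) t ` P) (- x) = solid_angle ((*\<^sub>R) (- t) ` P) x" for x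
    by simp
  have "- x \<in> \<int> \<times> \<int>" if "x \<in> \<int> \<times> \<int>" for x :: "real \<times> real"
    using that by auto
  then show ?thesis
    unfolding solid_angle_sum_def
    by (intro infsum_reindex_bij_witness[of _ uminus uminus]) (simp_all only: minus_minus reflect)
qed

lemma solid_angle_sum_eq_sum:
  assumes "finite S" "S \<subseteq> \<int> \<times> \<int>" "(*\<^sub>R) t ` P \<inter> \<int> \<times> \<int> \<subseteq> S"
  shows "solid_angle_sum P t = (\<Sum>x\<in>S. solid_angle ((*\<^sub>R) t ` P) x)"
proof -
  have outside: "solid_angle Q x = 0" if "x \<notin> Q" for Q x
    using that interior_subset by (auto simp: solid_angle_def)
  have "solid_angle_sum P t = (\<Sum>\<^sub>\<infinity>x\<in>S. solid_angle ((*\<^sub>R) t ` P) x)"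
    unfolding solid_angle_sum_def
    by (rule infsum_cong_neutral) (use assms(2,3) outside in blast)+
  then show ?thesis using assms(1) by simp
qed

section \<open>Triangles\<close>

lemma edge_of_triangle:
  fixes p q r :: "'a::euclidean_space"
  assumes "\<not> collinear {p, q, r}"
  shows "e edge_of convex hull {p, q, r} \<longleftrightarrow>
    e = closed_segment p q \<or> e = closed_segment p r \<or> e = closed_segment q r"
proof -
  have independent: "\<not> affine_dependent {p, q, r}" and distinct: "p \<noteq> q" "p \<noteq> r" "q \<noteq> r"
    using assms by (auto simp: collinear_3_eq_affine_dependent)
  show ?thesis
  proof
    assume "e edge_of convex hull {p, q, r}"
    then obtain V where V: "V \<subseteq> {p, q, r}" "e = convex hull V" and dim: "aff_dim e = 1"
      unfolding edge_of_def face_of_convex_hull_affine_independent[OF independent] by blast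
    have "\<not> affine_dependent V" using independent V(1) affine_dependent_subset by blast
    then have "card V = 2"
      using dim aff_dim_affine_independent[of V] by (simp add: V(2) aff_dim_convex_hull)
    then obtain u v where "V = {u, v}" "u \<noteq> v" by (auto simp: card_2_iff)
    then have "V = {p, q} \<or> V = {p, r} \<or> V = {q, r}" using V(1) by auto
    then show "e = closed_segment p q \<or> e = closed_segment p r \<or> e = closed_segment q r"
      by (auto simp: V(2) segment_convex_hull)
  next
    assume "e = closed_segment p q \<or> e = closed_segment p r \<or> e = closed_segment q r"
    moreover have "closed_segment u v edge_of convex hull {p, q, r}"
      if "{u, v} \<subseteq> {p, q, r}" "u \<noteq> v" for u v
      unfolding edge_of_def face_of_convex_hull_affine_independent[OF independent] using that
      by (intro conjI exI[of _ "{u, v}"]) (simp_all add: segment_convex_hull aff_dim_convex_hull)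
    ultimately show "e edge_of convex hull {p, q, r}"
      using distinct by auto
  qed
qed

lemma barycentric_coordinates_unique:
  fixes p q r :: "'a::euclidean_space"
  assumes "\<not> collinear {p, q, r}"
    and "\<alpha> + \<beta> + \<gamma> = \<alpha>' + \<beta>' + \<gamma>'"
    and "\<alpha> *\<^sub>R p + \<beta> *\<^sub>R q + \<gamma> *\<^sub>R r = \<alpha>' *\<^sub>R p + \<beta>' *\<^sub>R q + \<gamma>' *\<^sub>R r"
  shows "\<alpha> = \<alpha>' \<and> \<beta> = \<beta>' \<and> \<gamma> = \<gamma>'"
proof -
  have distinct: "p \<noteq> q" "p \<noteq> r" "q \<noteq> r" and independent: "\<not> affine_dependent {p, q, r}"
    using assms(1) by (auto simp: collinear_3_eq_affine_dependent)
  define change where "change x = (if x = p then \<alpha> - \<alpha>' else if x = q then \<beta> - \<beta>' else \<gamma> - \<gamma>')" for x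
  have "(\<Sum>x\<in>{p, q, r}. change x) = 0" "(\<Sum>x\<in>{p, q, r}. change x *\<^sub>R x) = 0"
    using distinct assms(2,3) by (auto simp: change_def algebra_simps)
  then have "\<forall>x\<in>{p, q, r}. change x = 0"
    using independent unfolding affine_dependent_explicit_finite[of "{p, q, r}", simplified] by auto
  then show ?thesis using distinct by (auto simp: change_def)
qed

context
  fixes p q r :: "'a::euclidean_space" and \<alpha> \<beta> \<gamma> :: real
  assumes triangle: "\<not> collinear {p, q, r}" and sum_1: "\<alpha> + \<beta> + \<gamma> = 1"
begin

lemma mem_triangle_barycentric:
  "\<alpha> *\<^sub>R p + \<beta> *\<^sub>R q + \<gamma> *\<^sub>R r \<in> convex hull {p, q, r} \<longleftrightarrow> 0 \<le> \<alpha> \<and> 0 \<le> \<beta> \<and> 0 \<le> \<gamma>"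
  using barycentric_coordinates_unique[OF triangle] sum_1
  unfolding convex_hull_3 mem_Collect_eq by metis

lemma mem_interior_triangle_barycentric:
  assumes "DIM('a) = 2"
  shows "\<alpha> *\<^sub>R p + \<beta> *\<^sub>R q + \<gamma> *\<^sub>R r \<in> interior (convex hull {p, q, r}) \<longleftrightarrow> 0 < \<alpha> \<and> 0 < \<beta> \<and> 0 < \<gamma>"
  using barycentric_coordinates_unique[OF triangle] sum_1
  unfolding interior_convex_hull_3_minimal[OF triangle assms] mem_Collect_eq by metis

lemma mem_open_segment_barycentric:
  "\<alpha> *\<^sub>R p + \<beta> *\<^sub>R q + \<gamma> *\<^sub>R r \<in> open_segment p q \<longleftrightarrow> 0 < \<alpha> \<and> 0 < \<beta> \<and> \<gamma> = 0"
proof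
  assume "\<alpha> *\<^sub>R p + \<beta> *\<^sub>R q + \<gamma> *\<^sub>R r \<in> open_segment p q"
  then obtain u where u: "0 < u" "u < 1"
    and "\<alpha> *\<^sub>R p + \<beta> *\<^sub>R q + \<gamma> *\<^sub>R r = (1 - u) *\<^sub>R p + u *\<^sub>R q + 0 *\<^sub>R r"
    by (auto simp: in_segment)
  then have "\<alpha> = 1 - u \<and> \<beta> = u \<and> \<gamma> = 0"
    using sum_1 by (intro barycentric_coordinates_unique[OF triangle]) auto
  then show "0 < \<alpha> \<and> 0 < \<beta> \<and> \<gamma> = 0" using u by simp
next
  assume pos: "0 < \<alpha> \<and> 0 < \<beta> \<and> \<gamma> = 0"
  then have "\<alpha> = 1 - \<beta>" using sum_1 by simp
  moreover have "p \<noteq> q" using triangle by (auto simp: collinear_3_eq_affine_dependent)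
  ultimately show "\<alpha> *\<^sub>R p + \<beta> *\<^sub>R q + \<gamma> *\<^sub>R r \<in> open_segment p q"
    using pos by (auto simp: in_segment)
qed

lemma mem_vertices_barycentric:
  "\<alpha> *\<^sub>R p + \<beta> *\<^sub>R q + \<gamma> *\<^sub>R r \<in> {p, q, r} \<longleftrightarrow>
    \<beta> = 0 \<and> \<gamma> = 0 \<or> \<alpha> = 0 \<and> \<gamma> = 0 \<or> \<alpha> = 0 \<and> \<beta> = 0"
  using barycentric_coordinates_unique[OF triangle, of \<alpha> \<beta> \<gamma> 1 0 0]
    barycentric_coordinates_unique[OF triangle, of \<alpha> \<beta> \<gamma> 0 1 0]
    barycentric_coordinates_unique[OF triangle, of \<alpha> \<beta> \<gamma> 0 0 1] sum_1 by auto

end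

lemma solid_angle_triangle:
  assumes triangle: "\<not> collinear {p, q, r}" and sum_1: "\<alpha> + \<beta> + \<gamma> = 1"
    and x_eq: "x = \<alpha> *\<^sub>R p + \<beta> *\<^sub>R q + \<gamma> *\<^sub>R r" and P_eq: "P = convex hull {p, q, r}"
  shows "solid_angle P x = (if x \<in> {p, q, r} then interior_angle P x / (2 * pi)
    else heaviside \<alpha> * heaviside \<beta> * heaviside \<gamma>)"
proof -
  have perms: "\<not> collinear {p, r, q}" "\<not> collinear {q, r, p}"
    and sums: "\<alpha> + \<gamma> + \<beta> = 1" "\<beta> + \<gamma> + \<alpha> = 1"
    and x_perms: "x = \<alpha> *\<^sub>R p + \<gamma> *\<^sub>R r + \<beta> *\<^sub>R q" "x = \<beta> *\<^sub>R q + \<gamma> *\<^sub>R r + \<alpha> *\<^sub>R p"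
    using triangle sum_1 x_eq by (simp_all add: insert_commute add_ac)
  have mem: "x \<in> P \<longleftrightarrow> 0 \<le> \<alpha> \<and> 0 \<le> \<beta> \<and> 0 \<le> \<gamma>"
    unfolding x_eq P_eq by (rule mem_triangle_barycentric[OF triangle sum_1])
  have interior: "x \<in> interior P \<longleftrightarrow> 0 < \<alpha> \<and> 0 < \<beta> \<and> 0 < \<gamma>"
    unfolding x_eq P_eq by (rule mem_interior_triangle_barycentric[OF triangle sum_1]) simp
  have open_pq: "x \<in> open_segment p q \<longleftrightarrow> 0 < \<alpha> \<and> 0 < \<beta> \<and> \<gamma> = 0"
    unfolding x_eq by (rule mem_open_segment_barycentric[OF triangle sum_1])
  have open_pr: "x \<in> open_segment p r \<longleftrightarrow> 0 < \<alpha> \<and> 0 < \<gamma> \<and> \<beta> = 0"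
    unfolding x_perms(1) by (rule mem_open_segment_barycentric[OF perms(1) sums(1)])
  have open_qr: "x \<in> open_segment q r \<longleftrightarrow> 0 < \<beta> \<and> 0 < \<gamma> \<and> \<alpha> = 0"
    unfolding x_perms(2) by (rule mem_open_segment_barycentric[OF perms(2) sums(2)])
  have distinct: "p \<noteq> q" "p \<noteq> r" "q \<noteq> r" and independent: "\<not> affine_dependent {p, q, r}"
    using triangle by (auto simp: collinear_3_eq_affine_dependent)
  have edge: "(\<exists>e. e edge_of P \<and> x \<in> rel_interior e) \<longleftrightarrow>
      0 < \<alpha> \<and> 0 < \<beta> \<and> \<gamma> = 0 \<or> 0 < \<alpha> \<and> 0 < \<gamma> \<and> \<beta> = 0 \<or> 0 < \<beta> \<and> 0 < \<gamma> \<and> \<alpha> = 0"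
    unfolding P_eq edge_of_triangle[OF triangle] using distinct
    by (simp add: conj_disj_distribR ex_disj_distrib rel_interior_closed_segment
        open_pq open_pr open_qr)
  have extreme: "x extreme_point_of P \<longleftrightarrow> x \<in> {p, q, r}"
    unfolding P_eq by (rule extreme_point_of_convex_hull_affine_independent[OF independent])
  have "x \<in> {p, q, r} \<longleftrightarrow> \<beta> = 0 \<and> \<gamma> = 0 \<or> \<alpha> = 0 \<and> \<gamma> = 0 \<or> \<alpha> = 0 \<and> \<beta> = 0"
    unfolding x_eq by (rule mem_vertices_barycentric[OF triangle sum_1])
  then show ?thesis
    unfolding solid_angle_def interior mem edge extreme using sum_1
    by (cases \<alpha> "0::real" rule: linorder_cases; cases \<beta> "0::real" rule: linorder_cases;
        cases \<gamma> "0::real" rule: linorder_cases) simp_all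
qed

lemma angle_between_commute: "angle_between u v = angle_between v u"
  by (simp add: angle_between_def inner_commute mult.commute)

lemma angle_between_orthogonal:
  assumes "orthogonal u v"
  shows "angle_between u v = pi / 2"
  using assms by (simp add: angle_between_def orthogonal_def)

lemma angle_between_add_orthogonal:
  assumes "orthogonal u v" "u \<noteq> 0"
  shows "angle_between u (u + v) = arctan (norm v / norm u)"
proof -
  have "inner u (u + v) / (norm u * norm (u + v)) = norm u / sqrt ((norm u)\<^sup>2 + (norm v)\<^sup>2)"
    using assms norm_add_Pythagorean[OF assms(1)]
    by (simp add: orthogonal_def inner_add_right power2_norm_eq_inner[symmetric] power2_eq_square
        real_sqrt_unique)
  also have "\<dots> = cos (arctan (norm v / norm u))"
  proof -
    have "1 + (norm v / norm u)\<^sup>2 = ((norm u)\<^sup>2 + (norm v)\<^sup>2) / (norm u)\<^sup>2"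
      using assms by (simp add: field_simps)
    then show ?thesis by (simp add: cos_arctan real_sqrt_divide)
  qed
  finally have "angle_between u (u + v) = arccos (cos (arctan (norm v / norm u)))"
    by (simp only: angle_between_def)
  moreover have "0 \<le> arctan (norm v / norm u)" "arctan (norm v / norm u) < pi / 2"
    using arctan_ubound by simp_all
  ultimately show ?thesis by (simp add: arccos_cos)
qed

lemma interior_angle_triangle:
  assumes "\<not> collinear {p, q, r}"
  shows "interior_angle (convex hull {p, q, r}) p = angle_between (q - p) (r - p)"
proof -
  have distinct: "p \<noteq> q" "p \<noteq> r" "q \<noteq> r"
    using assms by (auto simp: collinear_3_eq_affine_dependent)
  then have "closed_segment p a edge_of convex hull {p, q, r} \<longleftrightarrow> a = q \<or> a = r" for a
    by (auto simp: edge_of_triangle[OF assms] doubleton_eq_iff)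
  then have "interior_angle (convex hull {p, q, r}) p = (THE \<theta>. \<exists>a b. a \<noteq> b \<and>
      (a = q \<or> a = r) \<and> (b = q \<or> b = r) \<and> \<theta> = angle_between (a - p) (b - p))"
    by (simp only: interior_angle_def)
  also have "\<dots> = angle_between (q - p) (r - p)"
    using distinct(3) angle_between_commute by (intro the_equality) blast+
  finally show ?thesis .
qed

lemma not_collinear_right_triangle:
  fixes a b :: real
  assumes "a \<noteq> 0" "b \<noteq> 0"
  shows "\<not> collinear {(0, 0), (a, 0), (0, b)}"
  using assms collinear_lemma[of "(a, 0)" "(0, b)"] by (auto simp: zero_prod_def)

lemma interior_angle_right_triangle:
  assumes a_nonzero: "a \<noteq> 0" and b_nonzero: "b \<noteq> 0"
    and P_eq: "P = convex hull {(0, 0), (a, 0), (0, b)}"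
  shows "interior_angle P (0, 0) = pi / 2"
    and "interior_angle P (a, 0) = pi / 2 - arctan \<bar>a / b\<bar>"
    and "interior_angle P (0, b) = pi / 2 - arctan \<bar>b / a\<bar>"
proof -
  note triangle = not_collinear_right_triangle[OF a_nonzero b_nonzero]
  have arctan_abs_swap: "arctan (\<bar>d\<bar> / \<bar>c\<bar>) = pi / 2 - arctan \<bar>c / d\<bar>"
    if "c \<noteq> 0" "d \<noteq> 0" for c d :: real
    using that arctan_inverse[of "\<bar>c / d\<bar>"] by simp
  show "interior_angle P (0, 0) = pi / 2"
    unfolding P_eq interior_angle_triangle[OF triangle]
    by (rule angle_between_orthogonal) (simp add: orthogonal_def)
  have "interior_angle P (a, 0) = angle_between (- a, 0) (- a, b)"
    using interior_angle_triangle[of "(a, 0)" "(0, 0)" "(0, b)"] triangle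
    by (simp add: P_eq insert_commute)
  also have "\<dots> = pi / 2 - arctan \<bar>a / b\<bar>"
    using angle_between_add_orthogonal[of "(- a, 0)" "(0, b)"]
      arctan_abs_swap[OF a_nonzero b_nonzero] a_nonzero
    by (simp add: orthogonal_def zero_prod_def)
  finally show "interior_angle P (a, 0) = pi / 2 - arctan \<bar>a / b\<bar>" .
  have "interior_angle P (0, b) = angle_between (0, - b) (a, - b)"
    using interior_angle_triangle[of "(0, b)" "(0, 0)" "(a, 0)"] triangle
    by (simp add: P_eq insert_commute)
  also have "\<dots> = pi / 2 - arctan \<bar>b / a\<bar>"
    using angle_between_add_orthogonal[of "(0, - b)" "(a, 0)"]
      arctan_abs_swap[OF b_nonzero a_nonzero] b_nonzero
    by (simp add: orthogonal_def zero_prod_def)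
  finally show "interior_angle P (0, b) = pi / 2 - arctan \<bar>b / a\<bar>" .
qed

lemma solid_angle_right_triangle:
  assumes a_nonzero: "a \<noteq> 0" and b_nonzero: "b \<noteq> 0"
  shows "solid_angle (convex hull {(0, 0), (a, 0), (0, b)}) (x, y)
    = triangle_weight 1 (x / a) (y / b)
      - (if (x, y) = (a, 0) then arctan \<bar>a / b\<bar> / (2 * pi) else 0)
      - (if (x, y) = (0, b) then arctan \<bar>b / a\<bar> / (2 * pi) else 0)"
proof -
  define P where "P = convex hull {(0, 0), (a, 0), (0, b)}"
  have "(x, y) = (1 - x / a - y / b) *\<^sub>R (0, 0) + (x / a) *\<^sub>R (a, 0) + (y / b) *\<^sub>R (0, b)"
    using a_nonzero b_nonzero by simp
  then have "solid_angle P (x, y) = (if (x, y) \<in> {(0, 0), (a, 0), (0, b)}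
      then interior_angle P (x, y) / (2 * pi)
      else heaviside (1 - x / a - y / b) * heaviside (x / a) * heaviside (y / b))"
    by (intro solid_angle_triangle[OF not_collinear_right_triangle[OF a_nonzero b_nonzero]])
      (simp_all add: P_def)
  then show ?thesis
    using interior_angle_right_triangle[OF a_nonzero b_nonzero P_def] a_nonzero b_nonzero
    by (auto simp: triangle_weight_def diff_divide_distrib simp flip: P_def)
qed

lemma lattice_right_triangle_subset:
  assumes h_pos: "0 < h" and k_pos: "0 < k" and t_bounds: "0 < t" "t < real N"
  shows "convex hull {(0, 0), (real h * t, 0), (0, real k * t)} \<inter> \<int> \<times> \<int>
    \<subseteq> (\<lambda>(m, n). (real m, real n)) ` ({..<h * N} \<times> {..<k * N})"
proof clarify
  fix x y :: real
  assume "(x, y) \<in> convex hull {(0, 0), (real h * t, 0), (0, real k * t)}"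
  then obtain \<alpha> \<beta> \<gamma> where coords: "0 \<le> \<alpha>" "0 \<le> \<beta>" "0 \<le> \<gamma>" "\<alpha> + \<beta> + \<gamma> = 1"
    and x_eq: "x = \<beta> * (real h * t)" and y_eq: "y = \<gamma> * (real k * t)"
    unfolding convex_hull_3 by auto
  have lattice: "\<exists>m < l * N. z = real m" if "z \<in> \<int>" "z = \<delta> * (real l * t)" "0 \<le> \<delta>" "\<delta> \<le> 1" "0 < l"
    for z \<delta> l
  proof -
    have "z \<le> real l * t" using that t_bounds by (simp add: mult_left_le_one_le)
    also have "\<dots> < real (l * N)" using that t_bounds by simp
    finally have "z < real (l * N)" .
    moreover have "z \<in> \<nat>" using that t_bounds by (simp add: Nats_altdef2)
    then obtain m where "z = real m" by (rule Nats_cases)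
    ultimately show ?thesis by (metis of_nat_less_iff)
  qed
  assume "x \<in> \<int>" "y \<in> \<int>"
  then obtain m n where "m < h * N" "x = real m" "n < k * N" "y = real n"
    using lattice[OF _ x_eq] lattice[OF _ y_eq] coords h_pos k_pos by auto
  then show "(x, y) \<in> (\<lambda>(m, n). (real m, real n)) ` ({..<h * N} \<times> {..<k * N})"
    by auto
qed

lemma solid_angle_sum_right_triangle:
  assumes h_pos: "0 < h" and k_pos: "0 < k" and t_bounds: "0 < t" "t < real N"
  shows "solid_angle_sum (convex hull {(0, 0), (real h, 0), (0, real k)}) t
    = (\<Sum>m<h * N. \<Sum>n<k * N. triangle_weight t (real m / real h) (real n / real k))
      - arctan (real h / real k) / (2 * pi) * indicator \<int> (real h * t)
      - arctan (real k / real h) / (2 * pi) * indicator \<int> (real k * t)"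
proof -
  define a b where "a = real h * t" and "b = real k * t"
  have a_nonzero: "a \<noteq> 0" and b_nonzero: "b \<noteq> 0" using h_pos k_pos t_bounds by (auto simp: a_def b_def)
  define P where "P = convex hull {(0, 0), (a, 0), (0, b)}"
  define S where "S = (\<lambda>(m, n). (real m, real n)) ` ({..<h * N} \<times> {..<k * N})"
  have S_lattice: "finite S" "S \<subseteq> \<int> \<times> \<int>" "P \<inter> \<int> \<times> \<int> \<subseteq> S"
    using lattice_right_triangle_subset[OF h_pos k_pos t_bounds] by (auto simp: S_def P_def a_def b_def)
  have "(a, 0) \<in> P" "(0, b) \<in> P" by (auto simp: P_def intro: hull_inc)
  then have vertex: "(a, 0) \<in> S \<longleftrightarrow> a \<in> \<int>" "(0, b) \<in> S \<longleftrightarrow> b \<in> \<int>"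
    using S_lattice(2,3) by auto
  have image: "(*\<^sub>R) t ` (convex hull {(0, 0), (real h, 0), (0, real k)}) = P"
    by (simp add: P_def a_def b_def mult.commute flip: convex_hull_scaling)
  define weight where "weight = (\<lambda>(x, y). triangle_weight 1 (x / a) (y / b))"
  have weight: "weight (x, y) = triangle_weight t (x / real h) (y / real k)" for x y
    using triangle_weight_scale[of t 1 "x / a" "y / b"] t_bounds
    by (simp add: weight_def a_def b_def)
  have "solid_angle_sum (convex hull {(0, 0), (real h, 0), (0, real k)}) t
      = (\<Sum>p\<in>S. solid_angle P p)"
    using solid_angle_sum_eq_sum[OF S_lattice(1,2)] S_lattice(3) by (simp add: image)
  also have "\<dots> = (\<Sum>p\<in>S. weight p - (if p = (a, 0) then arctan \<bar>a / b\<bar> / (2 * pi) else 0)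
      - (if p = (0, b) then arctan \<bar>b / a\<bar> / (2 * pi) else 0))"
    by (intro sum.cong refl)
      (auto simp only: P_def weight_def solid_angle_right_triangle[OF a_nonzero b_nonzero] split: prod.split)
  also have "\<dots> = sum weight S - arctan \<bar>a / b\<bar> / (2 * pi) * indicator \<int> a
      - arctan \<bar>b / a\<bar> / (2 * pi) * indicator \<int> b"
    using S_lattice(1) by (simp add: sum_subtractf vertex)
  also have "sum weight S = (\<Sum>m<h * N. \<Sum>n<k * N. weight (real m, real n))"
    unfolding S_def sum.cartesian_product
    by (subst sum.reindex) (auto simp: inj_on_def case_prod_unfold)
  finally show ?thesis using t_bounds by (simp add: weight a_def b_def)
qed

theorem mainTheorem1:
  fixes h k :: nat and \<Delta> :: "(real \<times> real) set" and t :: real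
  assumes "0 < h" and "0 < k" and "coprime h k"
    and "\<Delta> = convex hull {(0, 0), (real h, 0), (0, real k)}"
    and "t \<noteq> 0"
  shows "solid_angle_sum \<Delta> t =
      real h * real k / 2 * t\<^sup>2 - B1_bar (real h * real k * t) * t
      + 1 / (2 * real h * real k)
          * (B2_bar (real h * real k * t) + ((real h)\<^sup>2 + (real k)\<^sup>2) / 6)
      - dedekind_rademacher_sum h k (real h * t) 0
      - dedekind_rademacher_sum k h (real k * t) 0
      - arctan (real h / real k) / (2 * pi) * indicator \<int> (real h * t)
      - arctan (real k / real h) / (2 * pi) * indicator \<int> (real k * t)"
proof -
  obtain N where t_less: "\<bar>t\<bar> < real N" using reals_Archimedean2 by blast
  have t_pos: "0 < \<bar>t\<bar>" using assms(5) by simp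
  have "solid_angle_sum \<Delta> t = solid_angle_sum \<Delta> \<bar>t\<bar>"
    by (simp add: abs_if solid_angle_sum_minus)
  also have "\<dots> = (\<Sum>i<h. \<Sum>j<k. translate_count \<bar>t\<bar> (real i / real h) (real j / real k))
      - arctan (real h / real k) / (2 * pi) * indicator \<int> (real h * \<bar>t\<bar>)
      - arctan (real k / real h) / (2 * pi) * indicator \<int> (real k * \<bar>t\<bar>)"
    unfolding assms(4) solid_angle_sum_right_triangle[OF assms(1,2) t_pos t_less]
      sum_triangle_weight_lattice[OF assms(1,2) t_pos t_less] ..
  finally show ?thesis
    unfolding sum_grid_translate_count[OF assms(1-3)]
    by (cases "0 \<le> t")
      (simp_all add: dedekind_rademacher_sum_minus indicator_def)
qed

end
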